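(* Let $m\ge 1$ be an integer, let $x_1,\dots,x_m$ be elements of a commutative ring, and let $C_m(x_1,\dots,x_m)$ be the $m\times m$ matrix whose $(p,q)$ entry is $x_{\max(p,\,m+1-q)}$ for $1\le p,q\le m$. Then $$\det C_m(x_1,\dots,x_m)=\begin{cases}(-1)^{\frac{m}{2}}\prod_{i=1}^{m}(x_i-x_{i+1}), & \text{if } m \text{ is even},\\[2pt] (-1)^{\frac{m-1}{2}}\prod_{i=1}^{m}(x_i-x_{i+1}), & \text{if } m \text{ is odd},\end{cases}$$ where $x_{m+1}=0$.
   Context: The matrix is, explicitly, $$C_m(x_1,\dots,x_m)=\begin{pmatrix} x_m & x_{m-1} & \cdots & x_2 & x_1\\ x_m & x_{m-1} & \cdots & x_2 & x_2\\ \vdots&\vdots&\ddots&\vdots&\vdots\\ x_m & x_{m-1} & \cdots & x_{m-1} & x_{m-1}\\ x_m & x_m&\cdots & x_m & x_m\end{pmatrix}.$$ *)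

theory Defs
  imports "Jordan_Normal_Form.Determinant"
begin

text \<open>Matrix entries are indexed from 0, so entry \<open>(i, j)\<close> is the one in row \<open>p = i + 1\<close> and
  column \<open>q = j + 1\<close>. The sequence \<open>x\<close> is indexed from 1; since \<open>q \<le> m\<close>, the subtraction
  \<open>m + 1 - q\<close> does not truncate and only \<open>x 1, \<dots>, x m\<close> occur.\<close>

definition C_mat :: "nat \<Rightarrow> (nat \<Rightarrow> 'a) \<Rightarrow> 'a mat" where
  "C_mat m x = mat m m (\<lambda>(i, j). let p = i + 1; q = j + 1 in x (max p (m + 1 - q)))"

end

theory Submission
  imports Defs
begin

text \<open>With \<open>d k = x k - x (k + 1)\<close>, telescoping gives
  \<open>x (max p r) = (\<Sum>k. of_bool (p \<le> k) * (of_bool (r \<le> k) * d k))\<close>. Hence \<open>C_mat m x\<close>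
  is the product of the upper unitriangular matrix of ones and a matrix that vanishes above the
  antidiagonal and carries the \<open>d k\<close> on it.\<close>

text \<open>Sign bookkeeping for the induction below: \<open>(- 1) ^ n\<close> is the cofactor sign
  of the top right entry of a matrix of size \<open>Suc n\<close>.\<close>

lemma minus_one_power_Suc_div_2:
  "(- 1 :: 'a :: comm_ring_1) ^ (Suc n div 2) = (- 1) ^ n * (- 1) ^ (n div 2)"
  by (cases "even n") simp_all

text \<open>Laplace expansion along the first row leaves only its last entry, and the complementary
  minor has the same shape, so induction on the size applies.\<close>

lemma det_lower_antitriangular:
  fixes A :: "'a :: comm_ring_1 mat"
  assumes "A \<in> carrier_mat n n"
    and "\<And>i j. i + j + 1 < n \<Longrightarrow> A $$ (i, j) = 0"
  shows "det A = (- 1) ^ (n div 2) * (\<Prod>i<n. A $$ (i, n - 1 - i))"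
  using assms
proof (induction n arbitrary: A)
  case 0
  then show ?case by simp
next
  case (Suc n)
  let ?B = "mat_delete A 0 n"
  have B: "?B \<in> carrier_mat n n"
    using Suc.prems(1) mat_delete_carrier[of A "Suc n" "Suc n"] by simp
  \<comment> \<open>Deleting the last column shifts no column index, so the vanishing condition for
    size \<open>n\<close> becomes the one for \<open>Suc n\<close>.\<close>
  have B_entry: "?B $$ (i, j) = A $$ (Suc i, j)" if "i < n" "j < n" for i j
    using Suc.prems(1) that by (auto simp: mat_delete_def)
  have "det ?B = (- 1) ^ (n div 2) * (\<Prod>i<n. ?B $$ (i, n - 1 - i))"
    by (rule Suc.IH[OF B]) (simp add: B_entry Suc.prems(2))
  also have "(\<Prod>i<n. ?B $$ (i, n - 1 - i)) = (\<Prod>i<n. A $$ (Suc i, n - Suc i))"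
    by (intro prod.cong) (auto simp: B_entry)
  finally have det_B: "det ?B = (- 1) ^ (n div 2) * (\<Prod>i<n. A $$ (Suc i, n - Suc i))" .
  have "det A = (\<Sum>j<Suc n. A $$ (0, j) * cofactor A 0 j)"
    using Suc.prems(1) by (rule laplace_expansion_row) simp
  also have "\<dots> = A $$ (0, n) * cofactor A 0 n"
    by (simp add: Suc.prems(2))
  also have "\<dots> = (- 1) ^ (Suc n div 2) * (A $$ (0, n) * (\<Prod>i<n. A $$ (Suc i, n - Suc i)))"
    unfolding cofactor_def det_B minus_one_power_Suc_div_2 by (simp add: algebra_simps)
  also have "A $$ (0, n) * (\<Prod>i<n. A $$ (Suc i, n - Suc i))
      = (\<Prod>i<Suc n. A $$ (i, Suc n - 1 - i))"
    by (subst prod.lessThan_Suc_shift) simp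
  finally show ?case .
qed

theorem proposition1p3:
  fixes m :: nat and x :: "nat \<Rightarrow> 'a :: comm_ring_1"
  assumes "m \<ge> 1" and "x (m + 1) = 0"
  shows "det (C_mat m x) =
    (if even m then (-1) ^ (m div 2) * (\<Prod>i = 1..m. x i - x (i + 1))
     else (-1) ^ ((m - 1) div 2) * (\<Prod>i = 1..m. x i - x (i + 1)))"
proof -
  \<comment> \<open>Matrix indices start at 0, so this \<open>d k\<close> is the difference with
    1-based index \<open>k + 1\<close>.\<close>
  define d where "d k = x (Suc k) - x (Suc (Suc k))" for k
  define U :: "'a mat" where "U = mat m m (\<lambda>(i, k). of_bool (i \<le> k))"
  define B where "B = mat m m (\<lambda>(k, j). of_bool (m \<le> j + k + 1) * d k)"
  have U: "U \<in> carrier_mat m m" and B: "B \<in> carrier_mat m m"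
    by (auto simp: U_def B_def)
  \<comment> \<open>The boundary term of the telescoping sum is
    \<open>x (m + 1) = 0\<close>.\<close>
  have telescope: "(\<Sum>k = r..<m. d k) = x (Suc r)" if "r \<le> m" for r
    using sum_Suc_diff'[OF that, of "\<lambda>k. - x (Suc k)"] assms(2) by (simp add: d_def)
  have "C_mat m x = U * B"
  proof (rule eq_matI)
    fix i j
    assume "i < dim_row (U * B)" "j < dim_col (U * B)"
    then have ij: "i < m" "j < m" using U B by auto
    \<comment> \<open>The indicators from \<open>U\<close> and \<open>B\<close> are both 1 exactly
      when \<open>r \<le> k\<close>, and \<open>Suc r\<close> is the index of \<open>x\<close> in
      \<open>C_mat\<close>.\<close>
    define r where "r = max i (m - Suc j)"
    have r: "r \<le> m" "Suc r = max (i + 1) (m + 1 - (j + 1))"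
      using ij by (auto simp: r_def)
    have "(U * B) $$ (i, j) = (\<Sum>k = 0..<m. of_bool (i \<le> k) * (of_bool (m \<le> j + k + 1) * d k))"
      using ij by (simp add: U_def B_def scalar_prod_def)
    also have "\<dots> = (\<Sum>k = 0..<m. if k \<in> {r..<m} then d k else 0)"
      by (intro sum.cong) (auto simp: r_def)
    also have "\<dots> = (\<Sum>k \<in> {0..<m} \<inter> {r..<m}. d k)"
      by (rule sum.inter_restrict[symmetric]) simp
    also have "{0..<m} \<inter> {r..<m} = {r..<m}"
      by auto
    also have "(\<Sum>k = r..<m. d k) = x (Suc r)"
      using r(1) by (rule telescope)
    finally show "C_mat m x $$ (i, j) = (U * B) $$ (i, j)"
      using ij r(2) by (simp add: C_mat_def Let_def)
  qed (use U B in \<open>auto simp: C_mat_def\<close>)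
  moreover have "det U = 1"
  proof -
    have "det U = prod_list (diag_mat U)"
      using U by (intro det_upper_triangular) (auto simp: U_def)
    also have "\<dots> = 1"
      using U by (simp add: prod_list_diag_prod) (simp add: U_def)
    finally show ?thesis .
  qed
  moreover have "det B = (- 1) ^ (m div 2) * (\<Prod>i<m. d i)"
  proof -
    have "det B = (- 1) ^ (m div 2) * (\<Prod>i<m. B $$ (i, m - 1 - i))"
      using B by (rule det_lower_antitriangular) (simp add: B_def)
    \<comment> \<open>On the antidiagonal \<open>j + k + 1 = m\<close>, so the indicator is
      1.\<close>
    also have "(\<Prod>i<m. B $$ (i, m - 1 - i)) = (\<Prod>i<m. d i)"
      by (intro prod.cong) (auto simp: B_def)
    finally show ?thesis .
  qed
  ultimately have "det (C_mat m x) = (- 1) ^ (m div 2) * (\<Prod>i<m. d i)"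
    using det_mult[OF U B] by simp
  also have "(\<Prod>i<m. d i) = (\<Prod>i = 1..m. x i - x (i + 1))"
    by (simp add: d_def prod.atLeast1_atMost_eq)
  finally show ?thesis
    \<comment> \<open>For odd \<open>m\<close>, \<open>(m - 1) div 2 = m div 2\<close>, so both
      cases are one formula.\<close>
    by (auto elim!: oddE)
qed

end
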